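(* $\mathrm{PDS}_3=\mathbf{[\mathcal{M}(c;(132),(123))]}\cup\mathbf{[\mathcal{M}(c;(123),(132))]}$, i.e. the set of all $3\times 3$ permutative doubly stochastic matrices is the union of the cogredient class of $[\mathcal{M}(c;(132),(123))]$ and the cogredient class of $[\mathcal{M}(c;(123),(132))]$.
   Context: A real $n\times n$ matrix is doubly stochastic if its entries are nonnegative and every row sum and column sum is $1$; $\Omega_n$ is the set of these. A matrix is permutative if every row is a permutation of its first row. $\mathrm{PDS}_n$ is the set of all $n\times n$ matrices that are both permutative and doubly stochastic. $\mathcal{S}_n$ is the group of $n\times n$ permutation matrices; a permutation $\pi\in S_n$ is identified with the matrix $P$ with $P_{ij}=1$ if $j=\pi(i)$ and $0$ otherwise. Vectors are row vectors. For $P_1,\dots,P_{n-1}\in\mathcal{S}_n$, $\mathcal{M}(c;P_1,\dots,P_{n-1})$ denotes the set of all doubly stochastic matrices whose rows are, in order, $c, cP_1,\dots,cP_{n-1}$, where $c=(c_1,\dots,c_n)$ is a row vector (treated as a vector of symbols, allowed to vary); the matrix with these rows and symbolic $c$ is the generic matrix. Further $[\mathcal{M}(c;P_1,\dots,P_{n-1})]=\{A\in\mathcal{M}(cP;P_1,\dots,P_{n-1}):P\in\mathcal{S}_n\}$. Two such classes $[\mathcal{M}(c;P_1,\dots,P_{n-1})]$ and $[\mathcal{M}(c;Q_1,\dots,Q_{n-1})]$ are cogredient if there are generic (symbolic) matrices $A$, $B$ representing them (respectively) and a permutation matrix $X$ with $X^TAX=B$. This is an equivalence relation, and the bold symbol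 $\mathbf{[\mathcal{M}(c;P_1,\dots,P_{n-1})]}$ denotes the equivalence class (cogredient class) of $[\mathcal{M}(c;P_1,\dots,P_{n-1})]$, regarded as the set of all matrices in its members. For $n=3$, the generic matrices of $\mathcal{M}(c;(132),(123))$ and $\mathcal{M}(c;(123),(132))$ are respectively $$\begin{pmatrix}c_1&c_2&c_3\\c_2&c_3&c_1\\c_3&c_1&c_2\end{pmatrix},\qquad \begin{pmatrix}c_1&c_2&c_3\\c_3&c_1&c_2\\c_2&c_3&c_1\end{pmatrix}.$$ *)

theory Defs
  imports
    "Jordan_Normal_Form.Matrix"
    "HOL-Combinatorics.Combinatorics"
    "HOL-Library.Poly_Mapping"
begin

definition doubly_stochastic :: "nat \<Rightarrow> real mat set" where
  "doubly_stochastic n = {A \<in> carrier_mat n n.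
     (\<forall>i<n. \<forall>j<n. 0 \<le> A $$ (i, j)) \<and>
     (\<forall>i<n. (\<Sum>j<n. A $$ (i, j)) = 1) \<and>
     (\<forall>j<n. (\<Sum>i<n. A $$ (i, j)) = 1)}"

definition permutative :: "'a mat \<Rightarrow> bool" where
  "permutative A \<longleftrightarrow> (\<forall>i<dim_row A. \<exists>\<sigma>. \<sigma> permutes {..<dim_col A} \<and>
     (\<forall>j<dim_col A. A $$ (i, j) = A $$ (0, \<sigma> j)))"

definition PDS :: "nat \<Rightarrow> real mat set" where
  "PDS n = {A \<in> doubly_stochastic n. permutative A}"

(* Permutations act on {1..n}, whereas matrix and vector indices start at 0;
   hence the shifts by Suc. *)

definition permutation_mat :: "nat \<Rightarrow> (nat \<Rightarrow> nat) \<Rightarrow> 'a::zero_neq_one mat" where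
  "permutation_mat n \<pi> = mat n n (\<lambda>(i, j). if Suc j = \<pi> (Suc i) then 1 else 0)"

(* The product c A of a row vector c with a matrix A. *)
definition row_vec_mult :: "'a::semiring_0 vec \<Rightarrow> 'a mat \<Rightarrow> 'a vec" where
  "row_vec_mult c A = vec (dim_col A) (\<lambda>j. c \<bullet> col A j)"

(* The matrix with rows c, c P\<^sub>1, ..., c P\<^sub>m.  It is polymorphic in the entries so
   that c may be a vector of real numbers or of indeterminates. *)
definition rows_mat ::
  "nat \<Rightarrow> 'a::{semiring_0, zero_neq_one} vec \<Rightarrow> (nat \<Rightarrow> nat) list \<Rightarrow> 'a mat" where
  "rows_mat n c Ps =
     mat_of_rows n (c # map (\<lambda>\<pi>. row_vec_mult c (permutation_mat n \<pi>)) Ps)"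

(* M_set n \<pi> Ps is M(c P; P\<^sub>1, ..., P\<^sub>m), where P is the matrix of \<pi> and c ranges over all
   real vectors; M(c; P\<^sub>1, ..., P\<^sub>m) is M_set n id Ps. *)
definition M_set :: "nat \<Rightarrow> (nat \<Rightarrow> nat) \<Rightarrow> (nat \<Rightarrow> nat) list \<Rightarrow> real mat set" where
  "M_set n \<pi> Ps = {A \<in> doubly_stochastic n. \<exists>c \<in> carrier_vec n.
     A = rows_mat n (row_vec_mult c (permutation_mat n \<pi>)) Ps}"

definition M_class :: "nat \<Rightarrow> (nat \<Rightarrow> nat) list \<Rightarrow> real mat set" where
  "M_class n Ps = (\<Union>\<pi> \<in> {\<pi>. \<pi> permutes {1..n}}. M_set n \<pi> Ps)"

(* Real polynomials in indeterminates indexed by nat: the inner mapping is a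
   monomial (its exponents), the outer one assigns the coefficients. *)
type_synonym polynomial = "(nat \<Rightarrow>\<^sub>0 nat) \<Rightarrow>\<^sub>0 real"

definition symbols :: "nat \<Rightarrow> polynomial vec" where
  "symbols n = vec n (\<lambda>i. Poly_Mapping.single (Poly_Mapping.single (Suc i) 1) 1)"

(* The generic matrices of all M(c P; P\<^sub>1, ..., P\<^sub>m), P a permutation matrix. *)
definition generic_mats :: "nat \<Rightarrow> (nat \<Rightarrow> nat) list \<Rightarrow> polynomial mat set" where
  "generic_mats n Ps =
     {rows_mat n (row_vec_mult (symbols n) (permutation_mat n \<pi>)) Ps | \<pi>. \<pi> permutes {1..n}}"

(* Cogredience depends on the generic matrices, so it is a relation between the tuples
   of permutations that present the classes, not between their sets of real matrices:
   distinct tuples may present the same set. *)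
definition cogredient :: "nat \<Rightarrow> (nat \<Rightarrow> nat) list \<Rightarrow> (nat \<Rightarrow> nat) list \<Rightarrow> bool" where
  "cogredient n Ps Qs \<longleftrightarrow> (\<exists>A \<in> generic_mats n Ps. \<exists>B \<in> generic_mats n Qs.
     \<exists>\<tau>. \<tau> permutes {1..n} \<and>
       transpose_mat (permutation_mat n \<tau>) * A * permutation_mat n \<tau> = B)"

definition cogredient_class :: "nat \<Rightarrow> (nat \<Rightarrow> nat) list \<Rightarrow> real mat set" where
  "cogredient_class n Ps =
     (\<Union>Qs \<in> {Qs. length Qs = n - 1 \<and> (\<forall>\<pi> \<in> set Qs. \<pi> permutes {1..n}) \<and>
        cogredient n Ps Qs}. M_class n Qs)"

end

theory Submission
  imports Defs
begin

text \<open>Let $u, v, w$ be the rows of a $3 \times 3$ permutative doubly stochastic matrix, each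
  reduced by $1/3$ in every entry.  The row sums put them in the plane of vectors with sum zero,
  the column sums give $u + v + w = 0$, and since $v$ and $w$ rearrange the entries of $u$,
  all three have the same Euclidean norm.  Three vectors of equal norm and sum zero in a plane
  are the corners of an equilateral triangle (possibly degenerate), so $v$ and $w$ arise from $u$
  by the rotations through $\pm 120$ degrees.  In this plane these rotations are the two cyclic
  shifts of the coordinates (\<open>equilateral_cyclic_shift\<close>).  Hence the rows of the matrix are
  $c$ and its two cyclic shifts, in one of two orders, and these are the two classes
  (\<open>PDS_3_subset_M_classes\<close>); each is contained in its cogredient class because
  cogredience is reflexive.

  For the converse, a cogredient class consists of doubly stochastic matrices with rows
  $cP, cPP_1, \dots, cPP_{n-1}$.  Each row is a rearrangement of the first, so
  these matrices are permutative (\<open>M_class_subset_PDS\<close>).\<close>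

section \<open>Permutation matrices acting on row vectors\<close>

lemma row_vec_mult_permutation_mat:
  fixes c :: "'a::semiring_1 vec"
  assumes "\<pi> permutes {1..n}" "c \<in> carrier_vec n" "i < n" "j < n" "\<pi> (Suc i) = Suc j"
  shows "row_vec_mult c (permutation_mat n \<pi>) $ j = c $ i"
proof -
  have eq: "Suc j = \<pi> (Suc k) \<longleftrightarrow> k = i" for k
    using permutes_inj[OF assms(1)] assms(5) by (metis injD nat.inject)
  have "row_vec_mult c (permutation_mat n \<pi>) $ j =
      (\<Sum>k\<in>{0..<n}. c $ k * (if k = i then 1 else 0))"
    using assms by (simp add: row_vec_mult_def permutation_mat_def scalar_prod_def eq)
  also have "\<dots> = (\<Sum>k\<in>{0..<n}. if k = i then c $ k else 0)"
    by (intro sum.cong) auto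
  finally show ?thesis
    using assms(3) by simp
qed

lemma row_vec_mult_permutation_mat_carrier [simp]:
  "row_vec_mult c (permutation_mat n \<pi>) \<in> carrier_vec n"
  by (simp add: row_vec_mult_def permutation_mat_def)

lemma permutation_mat_id: "permutation_mat n id = 1\<^sub>m n"
  by (rule eq_matI) (auto simp: permutation_mat_def)

lemma row_vec_mult_permutation_mat_id:
  fixes c :: "'a::semiring_1 vec"
  assumes "c \<in> carrier_vec n"
  shows "row_vec_mult c (permutation_mat n id) = c"
proof (rule eq_vecI)
  fix j assume "j < dim_vec c"
  then show "row_vec_mult c (permutation_mat n id) $ j = c $ j"
    using assms by (intro row_vec_mult_permutation_mat) (auto simp: permutes_id)
qed (use assms in \<open>simp add: row_vec_mult_def permutation_mat_def\<close>)

text \<open>The rearrangement is $\sigma = \pi^{-1}$, transported from $\{1,\dots,n\}$ to the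
  indices $0,\dots,n-1$.\<close>

lemma row_vec_mult_permutation_mat_rearranges:
  fixes c :: "'a::semiring_1 vec"
  assumes \<pi>: "\<pi> permutes {1..n}" and c: "c \<in> carrier_vec n"
  shows "\<exists>\<sigma>. \<sigma> permutes {..<n} \<and>
    (\<forall>j<n. row_vec_mult c (permutation_mat n \<pi>) $ j = c $ \<sigma> j)"
proof -
  define \<sigma> where "\<sigma> j = (if j < n then inv_into UNIV \<pi> (Suc j) - 1 else j)" for j
  have range: "inv_into UNIV \<pi> (Suc j) \<in> {1..n}" if "j < n" for j
    using permutes_in_image[OF permutes_inv[OF \<pi>], of "Suc j"] that by auto
  have \<sigma>: "\<sigma> j < n" "\<pi> (Suc (\<sigma> j)) = Suc j" if "j < n" for j
    using range[OF that] that permutes_inverses(1)[OF \<pi>] by (auto simp: \<sigma>_def)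
  have "inj_on \<sigma> {..<n}"
    using \<sigma>(2) by (metis inj_onI lessThan_iff nat.inject)
  then have "bij_betw \<sigma> {..<n} {..<n}"
    using \<sigma>(1) endo_inj_surj[of "{..<n}" \<sigma>] by (auto simp: bij_betw_def)
  then have "\<sigma> permutes {..<n}"
    by (rule bij_imp_permutes) (simp add: \<sigma>_def)
  moreover have "row_vec_mult c (permutation_mat n \<pi>) $ j = c $ \<sigma> j" if "j < n" for j
    using row_vec_mult_permutation_mat[OF \<pi> c \<sigma>(1)[OF that] that \<sigma>(2)[OF that]] .
  ultimately show ?thesis
    by blast
qed

section \<open>Cogredient classes and permutative matrices\<close>

lemma cogredient_refl:
  assumes "length Ps = n - 1" "n > 0"
  shows "cogredient n Ps Ps"
proof -
  define A where "A = rows_mat n (row_vec_mult (symbols n) (permutation_mat n id)) Ps"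
  have A: "A \<in> generic_mats n Ps"
    unfolding generic_mats_def A_def using permutes_id by blast
  have "A \<in> carrier_mat n n"
    unfolding A_def rows_mat_def using assms by (intro carrier_matI) simp_all
  then have "transpose_mat (permutation_mat n id) * A * permutation_mat n id = A"
    unfolding permutation_mat_id transpose_one by simp
  with A show ?thesis
    unfolding cogredient_def by (intro bexI[of _ A] exI[of _ id] conjI permutes_id)
qed

lemma M_class_subset_cogredient_class:
  assumes "length Ps = n - 1" "n > 0" "\<forall>\<pi>\<in>set Ps. \<pi> permutes {1..n}"
  shows "M_class n Ps \<subseteq> cogredient_class n Ps"
  unfolding cogredient_class_def using assms cogredient_refl by blast

lemma M_class_subset_PDS:
  assumes len: "length Ps = n - 1" and Ps: "\<forall>\<pi>\<in>set Ps. \<pi> permutes {1..n}"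
  shows "M_class n Ps \<subseteq> PDS n"
proof
  fix A assume "A \<in> M_class n Ps"
  then obtain c' \<pi> where A: "A \<in> doubly_stochastic n"
    and eq: "A = rows_mat n (row_vec_mult c' (permutation_mat n \<pi>)) Ps"
    unfolding M_class_def M_set_def by blast
  define c where "c = row_vec_mult c' (permutation_mat n \<pi>)"
  have c: "c \<in> carrier_vec n"
    by (simp add: c_def)
  have dim: "dim_row A = n" "dim_col A = n"
    using A by (auto simp: doubly_stochastic_def)
  have first: "A $$ (0, j) = c $ j" if "j < n" for j
    using that by (simp add: eq c_def rows_mat_def mat_of_rows_index)
  have "\<exists>\<sigma>. \<sigma> permutes {..<n} \<and> (\<forall>j<n. A $$ (i, j) = A $$ (0, \<sigma> j))" if i: "i < n" for i
  proof (cases i)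
    case 0
    then show ?thesis
      using permutes_id by fastforce
  next
    case (Suc k)
    then have k: "k < length Ps"
      using i len by simp
    have row: "A $$ (i, j) = row_vec_mult c (permutation_mat n (Ps ! k)) $ j" if "j < n" for j
      using that k Suc by (simp add: eq c_def rows_mat_def mat_of_rows_index)
    obtain \<sigma> where \<sigma>: "\<sigma> permutes {..<n}"
      "\<forall>j<n. row_vec_mult c (permutation_mat n (Ps ! k)) $ j = c $ \<sigma> j"
      using row_vec_mult_permutation_mat_rearranges[OF _ c] Ps k nth_mem by blast
    have "A $$ (i, j) = A $$ (0, \<sigma> j)" if "j < n" for j
      using row[OF that] \<sigma> that first[of "\<sigma> j"] permutes_in_image[OF \<sigma>(1), of j] by simp
    with \<sigma>(1) show ?thesis
      by blast
  qed
  then have "permutative A"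
    by (simp add: permutative_def dim)
  with A show "A \<in> PDS n"
    by (simp add: PDS_def)
qed

lemma cogredient_class_subset_PDS: "cogredient_class n Ps \<subseteq> PDS n"
  unfolding cogredient_class_def using M_class_subset_PDS by blast

text \<open>This makes the Euclidean norm, also after subtracting a constant from each entry, the
  same for all rows.\<close>

lemma permutative_row_sum:
  fixes f :: "'a \<Rightarrow> 'b::comm_monoid_add"
  assumes "permutative A" "i < dim_row A"
  shows "(\<Sum>j<dim_col A. f (A $$ (i, j))) = (\<Sum>j<dim_col A. f (A $$ (0, j)))"
proof -
  obtain \<sigma> where \<sigma>: "\<sigma> permutes {..<dim_col A}"
    "\<forall>j<dim_col A. A $$ (i, j) = A $$ (0, \<sigma> j)"
    using assms unfolding permutative_def by blast
  then have "(\<Sum>j<dim_col A. f (A $$ (i, j))) = (\<Sum>j<dim_col A. f (A $$ (0, \<sigma> j)))"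
    by simp
  also have "\<dots> = (\<Sum>j<dim_col A. f (A $$ (0, j)))"
    using sum.permute[OF \<sigma>(1), of "\<lambda>j. f (A $$ (0, j))"] by (simp add: o_def)
  finally show ?thesis .
qed

section \<open>Equilateral triangles in the plane of vectors with sum zero\<close>

text \<open>The hypotheses say that $u = (a,b,c)$, $v = (p,q,r)$ and $-u-v$ have sum zero and equal
  norms.  In the coordinates $(a,b)$ and $(p,q)$ this is one quadratic equation, for the norm of
  $v$, and one linear equation, for the inner product of $u$ and $v$, which has to be minus half
  the squared norm of $u$.  Eliminating $q$ leaves a quadratic equation for $p$.  Both cyclic
  shifts of $u$ solve the system, so unless $u = 0$, in which case also $v = 0$, the two roots
  are the first coordinates $b$ and $c$ of these shifts.\<close>

lemma equilateral_coordinate: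
  fixes a b c p q r :: real
  assumes "a + b + c = 0" "p + q + r = 0"
    and "p\<^sup>2 + q\<^sup>2 + r\<^sup>2 = a\<^sup>2 + b\<^sup>2 + c\<^sup>2"
    and "(a + p)\<^sup>2 + (b + q)\<^sup>2 + (c + r)\<^sup>2 = a\<^sup>2 + b\<^sup>2 + c\<^sup>2"
  shows "p = b \<or> p = c"
proof -
  \<comment> \<open>half the squared norm of $(a, b, c)$\<close>
  define N where "N = a\<^sup>2 + a * b + b\<^sup>2"
  have c: "c = - a - b" and r: "r = - p - q"
    using assms(1,2) by linarith+
  have norm: "p\<^sup>2 + p * q + q\<^sup>2 = N"
    using assms(3) unfolding c r N_def by (simp add: power2_eq_square algebra_simps)
  have inner: "(a + 2 * b) * q = - N - (2 * a + b) * p"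
    using assms(3,4) unfolding c r N_def by (simp add: power2_eq_square algebra_simps)
  \<comment> \<open>Multiplying the norm equation by $(a + 2b)^2$ eliminates $q$ without assuming that
    the coefficient $a + 2b$ is nonzero.\<close>
  have "3 * N * ((p - b) * (p - c)) =
      ((a + 2 * b) * p)\<^sup>2 + (a + 2 * b) * p * (- N - (2 * a + b) * p) +
      (- N - (2 * a + b) * p)\<^sup>2 - (a + 2 * b)\<^sup>2 * N"
    unfolding c N_def by (simp add: power2_eq_square algebra_simps)
  also have "\<dots> = (a + 2 * b)\<^sup>2 * (p\<^sup>2 + p * q + q\<^sup>2 - N)"
    unfolding inner[symmetric] by (simp add: power2_eq_square algebra_simps)
  also have "\<dots> = 0"
    by (simp add: norm)
  finally have "3 * N * ((p - b) * (p - c)) = 0" .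
  then consider "N = 0" | "p = b" | "p = c"
    by auto
  then show ?thesis
  proof cases
    case 1
    have "4 * N = (2 * a + b)\<^sup>2 + 3 * b\<^sup>2" "4 * N = (2 * p + q)\<^sup>2 + 3 * q\<^sup>2"
      "4 * N = (2 * q + p)\<^sup>2 + 3 * p\<^sup>2"
      using norm unfolding N_def by (simp_all add: power2_eq_square algebra_simps)
    with 1 have "b = 0" "p = 0"
      by (simp_all add: add_nonneg_eq_0_iff)
    then show ?thesis
      by simp
  qed auto
qed

text \<open>The hypotheses are invariant under simultaneous cyclic shifts of both vectors, so each
  coordinate of the second has one of two possible values.  Mixed choices make two of
  $a, b, c$ equal, and then agree with one of the shifts.\<close>

lemma equilateral_cyclic_shift:
  fixes a b c p q r :: real
  assumes "a + b + c = 0" "p + q + r = 0"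
    and "p\<^sup>2 + q\<^sup>2 + r\<^sup>2 = a\<^sup>2 + b\<^sup>2 + c\<^sup>2"
    and "(a + p)\<^sup>2 + (b + q)\<^sup>2 + (c + r)\<^sup>2 = a\<^sup>2 + b\<^sup>2 + c\<^sup>2"
  shows "p = b \<and> q = c \<and> r = a \<or> p = c \<and> q = a \<and> r = b"
proof -
  have "p = b \<or> p = c"
    using equilateral_coordinate[of a b c p q r] assms by simp
  moreover have "q = c \<or> q = a"
    using equilateral_coordinate[of b c a q r p] assms by (simp add: algebra_simps)
  moreover have "r = a \<or> r = b"
    using equilateral_coordinate[of c a b r p q] assms by (simp add: algebra_simps)
  ultimately show ?thesis
    using assms(1,2) by (elim disjE) auto
qed

section \<open>The three-dimensional case\<close>

lemma vec_3_eq_vec_of_list: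
  assumes "v \<in> carrier_vec 3"
  shows "v = vec_of_list [v $ 0, v $ 1, v $ 2]"
proof (rule eq_vecI)
  fix i assume "i < dim_vec (vec_of_list [v $ 0, v $ 1, v $ 2])"
  then have "i = 0 \<or> i = 1 \<or> i = 2"
    by auto
  then show "v $ i = vec_of_list [v $ 0, v $ 1, v $ 2] $ i"
    by (auto simp: numeral_2_eq_2)
qed (simp add: carrier_vecD[OF assms])

lemma PDS_3_cyclic_rows:
  assumes "A \<in> PDS 3"
  defines "c \<equiv> row A 0"
  shows "(row A 1 = vec_of_list [c $ 1, c $ 2, c $ 0] \<and> row A 2 = vec_of_list [c $ 2, c $ 0, c $ 1]) \<or>
    (row A 1 = vec_of_list [c $ 2, c $ 0, c $ 1] \<and> row A 2 = vec_of_list [c $ 1, c $ 2, c $ 0])"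
proof -
  have A: "A \<in> doubly_stochastic 3" "permutative A"
    using assms by (auto simp: PDS_def)
  then have dim: "dim_row A = 3" "dim_col A = 3"
    by (auto simp: doubly_stochastic_def)
  have sum3: "(\<Sum>j<3. f j) = f 0 + f 1 + f 2" for f :: "nat \<Rightarrow> real"
    by (simp add: eval_nat_numeral)
  have rows: "A $$ (i, 0) + A $$ (i, 1) + A $$ (i, 2) = 1" if "i < 3" for i
    using A(1) that by (simp add: doubly_stochastic_def sum3)
  have cols: "A $$ (0, j) + A $$ (1, j) + A $$ (2, j) = 1" if "j < 3" for j
    using A(1) that by (simp add: doubly_stochastic_def sum3)
  \<comment> \<open>Subtracting $1/3$ moves the rows into the plane of vectors with sum zero.\<close>
  define u where "u i j = A $$ (i, j) - 1 / 3" for i j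
  have sum0: "u i 0 + u i 1 + u i 2 = 0" if "i < 3" for i
    using rows[OF that] by (simp add: u_def)
  have third: "u 2 j = - (u 0 j + u 1 j)" if "j < 3" for j
    using cols[OF that] by (simp add: u_def)
  have norms: "(u i 0)\<^sup>2 + (u i 1)\<^sup>2 + (u i 2)\<^sup>2 = (u 0 0)\<^sup>2 + (u 0 1)\<^sup>2 + (u 0 2)\<^sup>2" if "i < 3" for i
    using permutative_row_sum[OF A(2), of i "\<lambda>x. (x - 1 / 3)\<^sup>2"] that
    by (simp add: dim sum3 u_def)
  have "u 1 0 = u 0 1 \<and> u 1 1 = u 0 2 \<and> u 1 2 = u 0 0 \<or>
      u 1 0 = u 0 2 \<and> u 1 1 = u 0 0 \<and> u 1 2 = u 0 1"
  proof (rule equilateral_cyclic_shift)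
    show "(u 0 0 + u 1 0)\<^sup>2 + (u 0 1 + u 1 1)\<^sup>2 + (u 0 2 + u 1 2)\<^sup>2 =
        (u 0 0)\<^sup>2 + (u 0 1)\<^sup>2 + (u 0 2)\<^sup>2"
      using norms[of 2] by (simp add: third power2_eq_square algebra_simps)
  qed (use sum0[of 0] sum0[of 1] norms[of 1] in simp_all)
  moreover have total: "u 0 0 + u 0 1 + u 0 2 = 0" "u 2 0 = - (u 0 0 + u 1 0)"
    "u 2 1 = - (u 0 1 + u 1 1)" "u 2 2 = - (u 0 2 + u 1 2)"
    using sum0[of 0] third[of 0] third[of 1] third[of 2] by simp_all
  ultimately have "(A $$ (1, 0) = A $$ (0, 1) \<and> A $$ (1, 1) = A $$ (0, 2) \<and> A $$ (1, 2) = A $$ (0, 0) \<and>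
      A $$ (2, 0) = A $$ (0, 2) \<and> A $$ (2, 1) = A $$ (0, 0) \<and> A $$ (2, 2) = A $$ (0, 1)) \<or>
    (A $$ (1, 0) = A $$ (0, 2) \<and> A $$ (1, 1) = A $$ (0, 0) \<and> A $$ (1, 2) = A $$ (0, 1) \<and>
      A $$ (2, 0) = A $$ (0, 1) \<and> A $$ (2, 1) = A $$ (0, 2) \<and> A $$ (2, 2) = A $$ (0, 0))"
  proof (elim disjE conjE, goal_cases)
    case 1
    then show ?case
      using total unfolding u_def by (intro disjI1 conjI; linarith)
  next
    case 2
    then show ?case
      using total unfolding u_def by (intro disjI2 conjI; linarith)
  qed
  moreover have "row A i = vec_of_list [A $$ (i, 0), A $$ (i, 1), A $$ (i, 2)]" if "i < 3" for i
  proof -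
    have "row A i \<in> carrier_vec 3"
      by (intro carrier_vecI) (simp only: index_row dim)
    then have "row A i = vec_of_list [row A i $ 0, row A i $ 1, row A i $ 2]"
      by (rule vec_3_eq_vec_of_list)
    moreover have "row A i $ 0 = A $$ (i, 0)" "row A i $ 1 = A $$ (i, 1)" "row A i $ 2 = A $$ (i, 2)"
      using that by (simp_all add: dim)
    ultimately show ?thesis
      by (simp only:)
  qed
  from this[of 1] this[of 2]
  have "row A 1 = vec_of_list [A $$ (1, 0), A $$ (1, 1), A $$ (1, 2)]"
    "row A 2 = vec_of_list [A $$ (2, 0), A $$ (2, 1), A $$ (2, 2)]"
    by (simp_all only: one_less_numeral_iff semiring_norm numeral_less_iff)
  moreover have "c $ j = A $$ (0, j)" if "j < 3" for j
    using that by (simp add: c_def dim)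
  then have "c $ 0 = A $$ (0, 0)" "c $ 1 = A $$ (0, 1)" "c $ 2 = A $$ (0, 2)"
    by simp_all
  ultimately show ?thesis
    by (elim disjE conjE) (simp_all only: simp_thms)
qed

lemma cycles_of_three:
  "cycle_of_list [1, 2, 3 :: nat] permutes {1..3}"
  "cycle_of_list [1, 3, 2 :: nat] permutes {1..3}"
proof -
  have "{1..3} = set [1, 2, 3 :: nat]" "{1..3} = set [1, 3, 2 :: nat]"
    by auto
  then show "cycle_of_list [1, 2, 3 :: nat] permutes {1..3}"
    "cycle_of_list [1, 3, 2 :: nat] permutes {1..3}"
    using cycle_permutes by metis+
qed

lemma row_vec_mult_cycles_of_three:
  fixes c :: "'a::semiring_1 vec"
  assumes c: "c \<in> carrier_vec 3"
  shows "row_vec_mult c (permutation_mat 3 (cycle_of_list [1, 3, 2])) = vec_of_list [c $ 1, c $ 2, c $ 0]"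
    and "row_vec_mult c (permutation_mat 3 (cycle_of_list [1, 2, 3])) = vec_of_list [c $ 2, c $ 0, c $ 1]"
proof -
  note entry = row_vec_mult_permutation_mat[OF _ c]
  let ?v = "\<lambda>\<pi>. row_vec_mult c (permutation_mat 3 \<pi>)"
  have "?v (cycle_of_list [1, 3, 2]) $ 0 = c $ 1" "?v (cycle_of_list [1, 3, 2]) $ 1 = c $ 2"
    "?v (cycle_of_list [1, 3, 2]) $ 2 = c $ 0"
    by (rule entry[OF cycles_of_three(2)]; simp add: transpose_def)+
  then show "?v (cycle_of_list [1, 3, 2]) = vec_of_list [c $ 1, c $ 2, c $ 0]"
    by (metis vec_3_eq_vec_of_list row_vec_mult_permutation_mat_carrier)
  have "?v (cycle_of_list [1, 2, 3]) $ 0 = c $ 2" "?v (cycle_of_list [1, 2, 3]) $ 1 = c $ 0"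
    "?v (cycle_of_list [1, 2, 3]) $ 2 = c $ 1"
    by (rule entry[OF cycles_of_three(1)]; simp add: transpose_def)+
  then show "?v (cycle_of_list [1, 2, 3]) = vec_of_list [c $ 2, c $ 0, c $ 1]"
    by (metis vec_3_eq_vec_of_list row_vec_mult_permutation_mat_carrier)
qed

lemma in_M_classI:
  assumes "A \<in> doubly_stochastic n" "c \<in> carrier_vec n" "A = rows_mat n c Ps"
  shows "A \<in> M_class n Ps"
proof -
  have "A \<in> M_set n id Ps"
    using assms row_vec_mult_permutation_mat_id[OF assms(2)] unfolding M_set_def by force
  then show ?thesis
    unfolding M_class_def using permutes_id by blast
qed

lemma PDS_3_subset_M_classes:
  "PDS 3 \<subseteq> M_class 3 [cycle_of_list [1, 3, 2], cycle_of_list [1, 2, 3]] \<union>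
    M_class 3 [cycle_of_list [1, 2, 3], cycle_of_list [1, 3, 2]]"
proof
  fix A assume A: "A \<in> PDS 3"
  define c where "c = row A 0"
  have ds: "A \<in> doubly_stochastic 3"
    using A by (simp add: PDS_def)
  then have dim: "A \<in> carrier_mat 3 3"
    by (simp add: doubly_stochastic_def)
  then have c: "c \<in> carrier_vec 3"
    unfolding c_def by (metis row_carrier_vec zero_less_numeral)
  have rows: "A = rows_mat 3 c [\<pi>, \<rho>]"
    if "row A 1 = row_vec_mult c (permutation_mat 3 \<pi>)"
      "row A 2 = row_vec_mult c (permutation_mat 3 \<rho>)" for \<pi> \<rho>
  proof -
    have "rows A = [row A 0, row A 1, row A 2]"
      using dim by (simp add: rows_def eval_nat_numeral)
    then have "rows_mat 3 c [\<pi>, \<rho>] = mat_of_rows 3 (rows A)"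
      using that by (simp only: rows_mat_def c_def list.map)
    then show ?thesis
      using dim mat_of_rows_rows[of A] by simp
  qed
  have "A = rows_mat 3 c [cycle_of_list [1, 3, 2], cycle_of_list [1, 2, 3]] \<or>
      A = rows_mat 3 c [cycle_of_list [1, 2, 3], cycle_of_list [1, 3, 2]]"
    using PDS_3_cyclic_rows[OF A, folded c_def] rows
    unfolding row_vec_mult_cycles_of_three[OF c, symmetric] by blast
  then show "A \<in> M_class 3 [cycle_of_list [1, 3, 2], cycle_of_list [1, 2, 3]] \<union>
      M_class 3 [cycle_of_list [1, 2, 3], cycle_of_list [1, 3, 2]]"
    using in_M_classI[OF ds c] by blast
qed

theorem theorem2p4:
  shows "PDS 3 =
    cogredient_class 3 [cycle_of_list [1, 3, 2], cycle_of_list [1, 2, 3]] \<union>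
    cogredient_class 3 [cycle_of_list [1, 2, 3], cycle_of_list [1, 3, 2]]"
proof (rule equalityI)
  have "M_class 3 [\<pi>, \<rho>] \<subseteq> cogredient_class 3 [\<pi>, \<rho>]"
    if "\<pi> permutes {1..3}" "\<rho> permutes {1..3}" for \<pi> \<rho>
    using that by (intro M_class_subset_cogredient_class) auto
  then show "PDS 3 \<subseteq>
      cogredient_class 3 [cycle_of_list [1, 3, 2], cycle_of_list [1, 2, 3]] \<union>
      cogredient_class 3 [cycle_of_list [1, 2, 3], cycle_of_list [1, 3, 2]]"
    using PDS_3_subset_M_classes cycles_of_three by blast
  show "cogredient_class 3 [cycle_of_list [1, 3, 2], cycle_of_list [1, 2, 3]] \<union>
      cogredient_class 3 [cycle_of_list [1, 2, 3], cycle_of_list [1, 3, 2]] \<subseteq> PDS 3"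
    using cogredient_class_subset_PDS by blast
qed

end
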